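(* Let $M \ge 2$ and $N \ge 1$ be integers and let $K \ge 2$ be a real number. The speedup factor of any federated scheduling algorithm with respect to any optimal scheduling algorithm, for constrained-deadline sporadic task systems with DAG structures with $N$ tasks on $M$ identical processors, is at least $\min\left\{\left(1-\frac{1}{K}\right)M,\ N - \frac{N-1}{K}\right\}$. More precisely, there exists a constrained-deadline sporadic DAG task system with $N$ tasks that admits a feasible schedule on $M$ identical unit-speed processors, but that admits no feasible federated schedule on $M$ processors of speed $s$ whenever $s < \left(1-\frac{1}{K}\right)M$ and $s < N - \frac{N-1}{K}$.
   Context: Sporadic task model: a task $\tau_i$ has a worst-case execution time (total work) $C_i$, a relative deadline $D_i$ and a minimum inter-arrival time $T_i$; it releases an infinite sequence of jobs, consecutive releases separated by at least $T_i$, and each job released at time $r$ must complete its work by $r + D_i$. A task system is constrained-deadline if $D_i \le T_i$ for every task. In the DAG task model, the work of a job is divided into subtasks whose precedence constraints form a directed acyclic graph; a subtask runs on one processor at a time, but subtasks with no precedence relation may execute in parallel on different processors. A processor of speed $s$ completes $s$ units of work per unit of time. A schedule is feasible if, for every legal sequence of job releases, no job misses its deadline and all scheduling constraints (precedence constraints, inter-arrival separation) are respected. An optimal scheduling algorithm produces a feasible schedule whenever one exists. A federated schedule is one in which each task either (1) is restricted to execute sequentially on a single processor (which may be shared with other such sequential tasks), or (2) is granted exclusive access to a set of processors on which only that task executes. A scheduling algorithm $\mathcal{A}$ has speedup factor $s$ with respect to a scheduling algorithm $\mathcal{B}$ if for every task system that $\mathcal{B}$ schedules feasibly on the given platform,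 the schedule produced by $\mathcal{A}$ is feasible when each processor is sped up to $s$ times its original speed. *)

theory Defs
  imports "HOL-Analysis.Analysis"
begin

text \<open>
  The worst-case execution time of a task is the total \<open>work\<close> of its \<open>subtasks\<close>; every job of the
  task requires exactly this amount.  A pair \<open>(u, v)\<close> in \<open>precedence\<close> means that \<open>u\<close> must complete
  before \<open>v\<close> starts.
\<close>

record dag_task =
  subtasks :: "nat set"
  precedence :: "(nat \<times> nat) set"
  work :: "nat \<Rightarrow> real"
  deadline :: real
  period :: real

definition dag_task :: "dag_task \<Rightarrow> bool" where
  "dag_task \<tau> \<longleftrightarrow>
     finite (subtasks \<tau>) \<and> subtasks \<tau> \<noteq> {} \<and>
     precedence \<tau> \<subseteq> subtasks \<tau> \<times> subtasks \<tau> \<and> acyclic (precedence \<tau>) \<and>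
     (\<forall>v\<in>subtasks \<tau>. 0 < work \<tau> v) \<and>
     0 < deadline \<tau> \<and> 0 < period \<tau>"

definition constrained_deadline_system :: "dag_task list \<Rightarrow> bool" where
  "constrained_deadline_system ts \<longleftrightarrow> (\<forall>\<tau>\<in>set ts. dag_task \<tau> \<and> deadline \<tau> \<le> period \<tau>)"

text \<open>\<open>r i k\<close> is the release time of the \<open>k\<close>-th job of task \<open>i\<close>.\<close>

type_synonym releases = "nat \<Rightarrow> nat \<Rightarrow> real"

definition legal_releases :: "dag_task list \<Rightarrow> releases \<Rightarrow> bool" where
  "legal_releases ts r \<longleftrightarrow>
     (\<forall>i<length ts. 0 \<le> r i 0 \<and> (\<forall>k. r i k + period (ts ! i) \<le> r i (Suc k)))"

text \<open>
  \<open>e p t = Some (i, k, v)\<close>: processor \<open>p\<close> executes subtask \<open>v\<close> of the \<open>k\<close>-th job of task \<open>i\<close> at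
  time \<open>t\<close>; \<open>e p t = None\<close>: processor \<open>p\<close> idles at time \<open>t\<close>.
\<close>

type_synonym execution = "nat \<Rightarrow> real \<Rightarrow> (nat \<times> nat \<times> nat) option"

text \<open>
  Work completed before time \<open>t\<close> on \<open>M\<close> processors of speed \<open>s\<close>.  Time starts at \<open>0\<close>, since no job
  is released earlier.
\<close>

definition received_work ::
  "nat \<Rightarrow> real \<Rightarrow> execution \<Rightarrow> nat \<times> nat \<times> nat \<Rightarrow> real \<Rightarrow> real" where
  "received_work M s e x t = (\<Sum>p<M. s * measure lborel {u \<in> {0..<t}. e p u = Some x})"

text \<open>
  Execution is preemptive, and a subtask may migrate between processors.  Measurability makes
  \<open>received_work\<close> meaningful.
\<close>

definition valid_execution ::
  "nat \<Rightarrow> real \<Rightarrow> dag_task list \<Rightarrow> releases \<Rightarrow> execution \<Rightarrow> bool" where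
  "valid_execution M s ts r e \<longleftrightarrow>
     (\<forall>p x. {t. e p t = Some x} \<in> sets borel) \<and>
     (\<forall>p q t x. e p t = Some x \<longrightarrow> e q t = Some x \<longrightarrow> p = q) \<and>
     (\<forall>p t i k v. e p t = Some (i, k, v) \<longrightarrow>
        p < M \<and> i < length ts \<and> v \<in> subtasks (ts ! i) \<and> r i k \<le> t \<and>
        received_work M s e (i, k, v) t < work (ts ! i) v \<and>
        (\<forall>u. (u, v) \<in> precedence (ts ! i) \<longrightarrow>
           work (ts ! i) u \<le> received_work M s e (i, k, u) t))"

definition meets_deadlines ::
  "nat \<Rightarrow> real \<Rightarrow> dag_task list \<Rightarrow> releases \<Rightarrow> execution \<Rightarrow> bool" where
  "meets_deadlines M s ts r e \<longleftrightarrow>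
     (\<forall>i<length ts. \<forall>k. \<forall>v\<in>subtasks (ts ! i).
        work (ts ! i) v \<le> received_work M s e (i, k, v) (r i k + deadline (ts ! i)))"

text \<open>
  A schedule prescribes an execution for each release sequence.  As usual for feasibility of sporadic
  task systems, it may depend on future releases.
\<close>

type_synonym schedule = "releases \<Rightarrow> execution"

definition feasible_schedule ::
  "nat \<Rightarrow> real \<Rightarrow> dag_task list \<Rightarrow> schedule \<Rightarrow> bool" where
  "feasible_schedule M s ts S \<longleftrightarrow>
     (\<forall>r. legal_releases ts r \<longrightarrow>
        valid_execution M s ts r (S r) \<and> meets_deadlines M s ts r (S r))"

datatype allocation = Sequential nat | Dedicated "nat set"

fun processors :: "allocation \<Rightarrow> nat set" where
  "processors (Sequential p) = {p}"
| "processors (Dedicated P) = P"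

definition valid_allocation :: "nat \<Rightarrow> nat \<Rightarrow> (nat \<Rightarrow> allocation) \<Rightarrow> bool" where
  "valid_allocation M n a \<longleftrightarrow>
     (\<forall>i<n. processors (a i) \<subseteq> {..<M}) \<and>
     (\<forall>i<n. \<forall>P. a i = Dedicated P \<longrightarrow> (\<forall>j<n. j \<noteq> i \<longrightarrow> processors (a j) \<inter> P = {}))"

text \<open>
  The allocation is fixed for all release sequences.  A task allocated a single processor runs
  sequentially because a processor executes one subtask at a time.
\<close>

definition federated_schedule :: "nat \<Rightarrow> dag_task list \<Rightarrow> schedule \<Rightarrow> bool" where
  "federated_schedule M ts S \<longleftrightarrow>
     (\<exists>a. valid_allocation M (length ts) a \<and>
        (\<forall>r. legal_releases ts r \<longrightarrow>
           (\<forall>p t i k v. S r p t = Some (i, k, v) \<longrightarrow> p \<in> processors (a i))))"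

text \<open>
  An algorithm (for a fixed number of processors) produces a schedule from the task system and the
  processor speed.
\<close>

type_synonym algorithm = "dag_task list \<Rightarrow> real \<Rightarrow> schedule"

definition federated_algorithm :: "nat \<Rightarrow> algorithm \<Rightarrow> bool" where
  "federated_algorithm M A \<longleftrightarrow>
     (\<forall>ts s. constrained_deadline_system ts \<longrightarrow> 0 < s \<longrightarrow> federated_schedule M ts (A ts s))"

definition optimal_algorithm :: "nat \<Rightarrow> algorithm \<Rightarrow> bool" where
  "optimal_algorithm M A \<longleftrightarrow>
     (\<forall>ts s. constrained_deadline_system ts \<longrightarrow> 0 < s \<longrightarrow>
        (\<exists>S. feasible_schedule M s ts S) \<longrightarrow> feasible_schedule M s ts (A ts s))"

definition has_speedup_factor ::
  "nat \<Rightarrow> nat \<Rightarrow> algorithm \<Rightarrow> algorithm \<Rightarrow> real \<Rightarrow> bool" where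
  "has_speedup_factor M N A B s \<longleftrightarrow>
     0 < s \<and>
     (\<forall>ts. constrained_deadline_system ts \<longrightarrow> length ts = N \<longrightarrow>
        feasible_schedule M 1 ts (B ts 1) \<longrightarrow> feasible_schedule M s ts (A ts s))"

end

theory Submission
  imports Defs
begin

text \<open>
  Task \<open>i\<close> consists of \<open>M\<close> independent subtasks, and the tasks with index at most \<open>i\<close> together carry
  work \<open>M K\<^sup>i\<close>, where \<open>K\<^sup>i\<close> is the deadline of task \<open>i\<close>.  Running the \<open>p\<close>-th subtask of every task on
  processor \<open>p\<close> reduces feasibility to a single processor.  The common period is so long that a window
  as long as a deadline meets at most one job of each task, so giving priority to short deadlines
  leaves enough time for every job.  On the other hand every task has density at least
  \<open>(1 - 1/K) M\<close>, so a slower processor cannot serve a task sequentially, and if all tasks get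
  disjoint sets of processors, the total density \<open>M (N - (N - 1)/K)\<close> is at most \<open>M s\<close>.
\<close>

section \<open>Fixed-priority scheduling on one processor\<close>

text \<open>The times at which a job of work \<open>c\<close> released at \<open>\<rho>\<close> runs
  if it greedily uses all time outside \<open>B\<close>. No end point is named: the strict bound on
  the time used so far stops the job, and \<open>valid_execution\<close> asks for unfinished work in
  just this form.\<close>

definition claim :: "real set \<Rightarrow> real \<Rightarrow> real \<Rightarrow> real set" where
  "claim B \<rho> c = {t. \<rho> \<le> t \<and> t \<notin> B \<and> measure lborel ({\<rho>..<t} - B) < c}"

section \<open>Free time outside a set as a function of the end point\<close>

lemma fmeasurable_lborel_interval [simp]: "{a..<b::real} \<in> fmeasurable lborel"
  by (cases "a \<le> b") (auto simp: fmeasurable_def)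

lemma measure_interval_Diff_mono:
  fixes B :: "real set"
  assumes "B \<in> sets borel" "t \<le> u"
  shows "measure lborel ({\<rho>..<t} - B) \<le> measure lborel ({\<rho>..<u} - B)"
proof (rule measure_mono_fmeasurable)
  show "{\<rho>..<u} - B \<in> fmeasurable lborel" using assms by (intro fmeasurable_Diff) auto
qed (use assms in auto)

lemma measure_interval_Diff_le:
  fixes B :: "real set"
  assumes "B \<in> sets borel" "t \<le> u"
  shows "measure lborel ({\<rho>..<u} - B) \<le> measure lborel ({\<rho>..<t} - B) + (u - t)"
proof -
  have f: "{a..<b} - B \<in> fmeasurable lborel" for a b
    using assms by (intro fmeasurable_Diff) auto
  have "measure lborel ({\<rho>..<u} - B) \<le> measure lborel (({\<rho>..<t} - B) \<union> {t..<u})"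
    using f by (intro measure_mono_fmeasurable fmeasurable.Un) (auto simp: assms)
  also have "\<dots> \<le> measure lborel ({\<rho>..<t} - B) + measure lborel {t..<u}"
    using f by (intro measure_Un_le) (auto simp: assms)
  finally show ?thesis using assms by simp
qed

text \<open>From \<open>t\<close> to a later \<open>u\<close> the free time grows by an amount
  between \<open>0\<close> and \<open>u - t\<close>, so it is 1-Lipschitz.\<close>

lemma continuous_on_measure_interval_Diff:
  fixes B :: "real set"
  assumes "B \<in> sets borel"
  shows "continuous_on S (\<lambda>t. measure lborel ({\<rho>..<t} - B))"
proof (rule continuous_on_subset[OF lipschitz_on_continuous_on[of 1]])
  show "1-lipschitz_on UNIV (\<lambda>t. measure lborel ({\<rho>..<t} - B))"
  proof (rule lipschitz_onI)
    fix x y :: real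
    show "dist (measure lborel ({\<rho>..<x} - B)) (measure lborel ({\<rho>..<y} - B)) \<le> 1 * dist x y"
      using measure_interval_Diff_mono[OF assms, of x y \<rho>] measure_interval_Diff_le[OF assms, of x y \<rho>]
        measure_interval_Diff_mono[OF assms, of y x \<rho>] measure_interval_Diff_le[OF assms, of y x \<rho>]
      by (cases "x \<le> y") (auto simp: dist_real_def)
  qed auto
qed auto

text \<open>By \<open>free\<close>, the window of length \<open>d\<close> has at least
  \<open>c\<close> units of time outside \<open>B\<close>. Free time is continuous, so it takes the
  value \<open>c\<close> there; \<open>z\<close> is the first such time, which exists by
  compactness.\<close>

lemma claim_eq_interval:
  assumes B: "B \<in> sets borel" and c: "0 < c" and d: "0 \<le> d"
    and free: "c + measure lborel ({\<rho>..<\<rho> + d} \<inter> B) \<le> d"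
  obtains z where "\<rho> \<le> z" "z \<le> \<rho> + d" "claim B \<rho> c = {\<rho>..<z} - B"
    "measure lborel (claim B \<rho> c) = c"
proof -
  let ?g = "\<lambda>t. measure lborel ({\<rho>..<t} - B)"
  have cont: "continuous_on S ?g" for S
    by (rule continuous_on_measure_interval_Diff[OF B])
  have "measure lborel {\<rho>..<\<rho> + d} = measure lborel ({\<rho>..<\<rho> + d} - {\<rho>..<\<rho> + d} \<inter> B)
      + measure lborel ({\<rho>..<\<rho> + d} \<inter> B)"
    using B by (subst measurable_measure_Diff) auto
  moreover have "{\<rho>..<\<rho> + d} - {\<rho>..<\<rho> + d} \<inter> B = {\<rho>..<\<rho> + d} - B" by blast
  ultimately have g_end: "c \<le> ?g (\<rho> + d)" using free d by simp
  let ?Z = "{t \<in> {\<rho>..\<rho> + d}. ?g t = c}"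
  have "\<exists>t\<ge>\<rho>. t \<le> \<rho> + d \<and> ?g t = c"
    using g_end c d cont by (intro IVT') auto
  then have "?Z \<noteq> {}" by auto
  moreover have "compact ?Z"
  proof -
    have "closed ?Z" by (rule continuous_closed_preimage_constant[OF cont]) simp
    then show ?thesis
      by (metis (no_types, lifting) bounded_closed_interval bounded_subset compact_eq_bounded_closed
          mem_Collect_eq subsetI)
  qed
  ultimately obtain z where z: "z \<in> ?Z" and least: "\<And>t. t \<in> ?Z \<Longrightarrow> z \<le> t"
    using compact_attains_inf[of ?Z] by blast
  \<comment> \<open>If the value were already at least \<open>c\<close>, the intermediate value
    theorem would give a point of \<open>?Z\<close> before \<open>z\<close>.\<close>
  have "?g t < c" if "t < z" "\<rho> \<le> t" for t
  proof (rule ccontr)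
    assume "\<not> ?g t < c"
    then have "\<exists>u\<ge>\<rho>. u \<le> t \<and> ?g u = c"
      using c that cont by (intro IVT') auto
    then obtain u where "\<rho> \<le> u" "u \<le> t" "?g u = c" by blast
    then show False using least[of u] z that by auto
  qed
  moreover have "\<not> ?g t < c" if "z \<le> t" for t
    using measure_interval_Diff_mono[OF B that, of \<rho>] z by auto
  ultimately have eq: "claim B \<rho> c = {\<rho>..<z} - B"
    unfolding claim_def by (auto simp: not_le[symmetric])
  show thesis by (rule that[of z]) (use z eq in auto)
qed

text \<open>One processor's share of the workload; a lower index means higher priority. By
  \<open>demand\<close>, one job of each task up to \<open>i\<close> fits into a window of length
  \<open>d i\<close>, and \<open>long_period\<close> keeps two jobs of task \<open>j\<close> from
  both interfering with one window of task \<open>i\<close>.\<close>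

locale deadline_monotonic =
  fixes n :: nat and c d :: "nat \<Rightarrow> real" and T :: real and r :: releases
  assumes work_pos: "i < n \<Longrightarrow> 0 < c i"
    and demand: "i < n \<Longrightarrow> (\<Sum>j\<le>i. c j) \<le> d i"
    and long_period: "i < n \<Longrightarrow> j < n \<Longrightarrow> d i + d j \<le> T"
    and release_nonneg: "i < n \<Longrightarrow> 0 \<le> r i 0"
    and separated: "i < n \<Longrightarrow> r i k + T \<le> r i (Suc k)"
begin

text \<open>The time taken by the tasks with index below the argument. Jobs of the same task ignore
  each other here; their slots turn out disjoint because their windows are.\<close>

primrec busy :: "nat \<Rightarrow> real set" where
  "busy 0 = {}"
| "busy (Suc i) = busy i \<union> (\<Union>k. claim (busy i) (r i k) (c i))"

definition slot :: "nat \<Rightarrow> nat \<Rightarrow> real set" where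
  "slot i k = claim (busy i) (r i k) (c i)"

lemma busy_eq: "busy i = (\<Union>j<i. \<Union>k. slot j k)"
  by (induction i) (auto simp: slot_def lessThan_Suc)

lemma deadline_pos:
  assumes "i < n" shows "0 < d i"
proof -
  have "0 < (\<Sum>j\<le>i. c j)" using assms by (intro sum_pos) (auto intro: work_pos)
  then show ?thesis using demand[OF assms] by simp
qed

lemma period_pos: "i < n \<Longrightarrow> 0 < T"
  using deadline_pos[of i] long_period[of i i] by simp

lemma release_less:
  assumes "i < n" "k < l" shows "r i k + T \<le> r i l"
  using assms(2)
proof (induction l rule: less_Suc_induct)
  case (1 k) show ?case by (rule separated[OF assms(1)])
next
  case (2 k l m) then show ?case using period_pos[OF assms(1)] by simp
qed

lemma release_ge_0: "i < n \<Longrightarrow> 0 \<le> r i k"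
  using release_less[of i 0 k] release_nonneg[of i] period_pos[of i] by (cases k) auto

text \<open>Strong induction on the priority: slots of higher priority stay inside their windows, so
  at most one job of each such task meets the window of job \<open>k\<close>. They take at most the
  sum of \<open>c j\<close> over \<open>j < i\<close>, and \<open>demand\<close> leaves
  \<open>c i\<close>. Measurability, location and size all enter the induction hypothesis.\<close>

lemma slot_interval:
  assumes "i < n"
  shows "busy i \<in> sets borel \<and> (\<exists>z. r i k \<le> z \<and> z \<le> r i k + d i \<and> slot i k = {r i k..<z} - busy i)
    \<and> measure lborel (slot i k) = c i"
  using assms
proof (induction i arbitrary: k rule: less_induct)
  case (less i)
  have slot: "slot j l \<in> sets borel" "slot j l \<subseteq> {r j l..<r j l + d j}"
    "measure lborel (slot j l) = c j" if "j < i" for j l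
  proof -
    have "j < n" using that less.prems by simp
    from less.IH[OF that this, of l] obtain z where "busy j \<in> sets borel"
      "z \<le> r j l + d j" "slot j l = {r j l..<z} - busy j" "measure lborel (slot j l) = c j"
      by blast
    then show "slot j l \<in> sets borel" "slot j l \<subseteq> {r j l..<r j l + d j}"
      "measure lborel (slot j l) = c j" by auto
  qed
  have B: "busy i \<in> sets borel"
    unfolding busy_eq using slot(1) by (intro sets.countable_UN'') auto
  let ?W = "{r i k..<r i k + d i}"
  have le: "measure lborel (?W \<inter> (\<Union>l. slot j l)) \<le> c j" if j: "j < i" for j
  proof (cases "\<exists>l. ?W \<inter> slot j l \<noteq> {}")
    case True
    then obtain l where l: "?W \<inter> slot j l \<noteq> {}" by blast
    have jn: "j < n" using j less.prems by simp
    \<comment> \<open>Job \<open>m\<close> is released at least \<open>T \<ge> d i + d j\<close>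
      before or after job \<open>l\<close>, whose slot meets \<open>?W\<close>; hence the window of
      job \<open>m\<close> misses \<open>?W\<close>.\<close>
    have "?W \<inter> slot j m = {}" if "m \<noteq> l" for m
    proof -
      have "r j m + T \<le> r j l \<or> r j l + T \<le> r j m"
        using that release_less[OF jn] by (meson linorder_neqE_nat)
      moreover obtain x where "x \<in> ?W" "x \<in> {r j l..<r j l + d j}"
        using l slot(2)[OF j, of l] by blast
      ultimately have "r i k + d i \<le> r j m \<or> r j m + d j \<le> r i k"
        using long_period[OF less.prems jn] by auto
      then show ?thesis using slot(2)[OF j, of m] by fastforce
    qed
    then have "?W \<inter> (\<Union>l. slot j l) \<subseteq> slot j l" by (force simp: disjoint_iff)
    then have "measure lborel (?W \<inter> (\<Union>l. slot j l)) \<le> measure lborel (slot j l)"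
    proof (rule measure_mono_fmeasurable)
      show "?W \<inter> (\<Union>l. slot j l) \<in> sets lborel" using slot(1)[OF j] by auto
      show "slot j l \<in> fmeasurable lborel"
        by (rule fmeasurableI2[of "{r j l..<r j l + d j}"]) (use slot(1,2)[OF j] in auto)
    qed
    then show ?thesis using slot(3)[OF j] by simp
  next
    case False
    then have "?W \<inter> (\<Union>l. slot j l) = {}" by blast
    then show ?thesis using work_pos[of j] j less.prems by simp
  qed
  have "?W \<inter> busy i = (\<Union>j<i. ?W \<inter> (\<Union>l. slot j l))" unfolding busy_eq by blast
  also have "measure lborel \<dots> \<le> (\<Sum>j<i. measure lborel (?W \<inter> (\<Union>l. slot j l)))"
    using slot(1)
    by (intro measure_UNION_le) auto
  also have "\<dots> \<le> (\<Sum>j<i. c j)" using le by (intro sum_mono) auto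
  finally have "c i + measure lborel (?W \<inter> busy i) \<le> d i"
    using demand[OF less.prems] by (simp add: lessThan_Suc_atMost[symmetric])
  with B work_pos[OF less.prems] deadline_pos[OF less.prems] obtain z where
    "r i k \<le> z" "z \<le> r i k + d i" "claim (busy i) (r i k) (c i) = {r i k..<z} - busy i"
    "measure lborel (claim (busy i) (r i k) (c i)) = c i"
    by (metis claim_eq_interval less_imp_le)
  then show ?case using B unfolding slot_def by blast
qed

lemma busy_borel: "i < n \<Longrightarrow> busy i \<in> sets borel"
  using slot_interval by blast

lemma measure_slot: "i < n \<Longrightarrow> measure lborel (slot i k) = c i"
  using slot_interval by blast

lemma slot_borel: "i < n \<Longrightarrow> slot i k \<in> sets borel"
  using slot_interval[of i k] by auto

lemma slot_subset:
  assumes "i < n" shows "slot i k \<subseteq> {r i k..<r i k + d i}"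
  using slot_interval[OF assms, of k] by auto

text \<open>A claim avoids \<open>busy\<close>, which contains all slots of lower index. Two jobs of
  one task have disjoint windows, since \<open>d i < T\<close>.\<close>

lemma slot_unique:
  assumes "i < n" "j < n" "t \<in> slot i k" "t \<in> slot j l"
  shows "i = j \<and> k = l"
proof -
  have "t \<notin> slot j' l'" if "j' < i'" "t \<in> slot i' k'" for i' j' k' l'
    using that unfolding slot_def[of i'] claim_def busy_eq by blast
  then have "i = j" using assms(3,4) by (meson linorder_neqE_nat)
  moreover have "k = l"
  proof (rule ccontr)
    assume "k \<noteq> l"
    then have "r i k + T \<le> r i l \<or> r i l + T \<le> r i k"
      using release_less[OF assms(1)] by (meson linorder_neqE_nat)
    moreover have "r i k \<le> t" "t < r i k + d i" "r i l \<le> t" "t < r i l + d i"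
      using assms(3,4) \<open>i = j\<close> slot_subset[OF assms(1)] by fastforce+
    ultimately show False
      using long_period[OF assms(1) assms(1)] deadline_pos[OF assms(1)] by linarith
  qed
  ultimately show ?thesis by simp
qed

text \<open>Before \<open>t\<close> the job ran only at free times since its release, so the strict
  inequality in \<open>claim\<close> applies.\<close>

lemma measure_slot_before:
  assumes "i < n" "t \<in> slot i k"
  shows "measure lborel ({0..<t} \<inter> slot i k) < c i"
proof -
  have f: "{a..<b} - busy i \<in> fmeasurable lborel" for a b
    using busy_borel[OF assms(1)] by (intro fmeasurable_Diff) auto
  have "measure lborel ({0..<t} \<inter> slot i k) \<le> measure lborel ({r i k..<t} - busy i)"
  proof (rule measure_mono_fmeasurable)
    show "{0..<t} \<inter> slot i k \<subseteq> {r i k..<t} - busy i"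
      unfolding slot_def claim_def by auto
  qed (use f slot_borel[OF assms(1)] in auto)
  also have "\<dots> < c i" using assms(2) unfolding slot_def claim_def by blast
  finally show ?thesis .
qed

lemma slot_subset_before_deadline:
  "i < n \<Longrightarrow> slot i k \<subseteq> {0..<r i k + d i}"
  using slot_subset[of i k] release_ge_0[of i k] by auto

section \<open>Replicating the schedule on \<open>M\<close> processors\<close>

definition parallel_execution :: "nat \<Rightarrow> execution" where
  "parallel_execution M p t =
     (if p < M \<and> (\<exists>i k. i < n \<and> t \<in> slot i k)
      then (let (i, k) = (SOME (i, k). i < n \<and> t \<in> slot i k) in Some (i, k, p))
      else None)"

text \<open>The choice in the definition is harmless: by \<open>slot_unique\<close> at most one job
  has a slot containing \<open>t\<close>. All processors serve that job in lockstep, each its own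
  subtask.\<close>

lemma parallel_execution_eq_Some_iff:
  "parallel_execution M p t = Some (i, k, v) \<longleftrightarrow> p < M \<and> v = p \<and> i < n \<and> t \<in> slot i k"
proof (cases "p < M \<and> (\<exists>i k. i < n \<and> t \<in> slot i k)")
  case True
  then obtain i' k' where ik: "i' < n" "t \<in> slot i' k'" by blast
  have "(SOME (i, k). i < n \<and> t \<in> slot i k) = (i', k')"
    by (rule some_equality) (use ik slot_unique in auto)
  then have "parallel_execution M p t = Some (i', k', p)"
    using True by (simp add: parallel_execution_def)
  then show ?thesis using ik True slot_unique by auto
next
  case False
  then show ?thesis unfolding parallel_execution_def by auto
qed

lemma received_work_parallel_execution:
  assumes "i < n" "v < M"
  shows "received_work M 1 (parallel_execution M) (i, k, v) t = measure lborel ({0..<t} \<inter> slot i k)"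
proof -
  have "measure lborel {u \<in> {0..<t}. parallel_execution M p u = Some (i, k, v)}
      = (if p = v then measure lborel ({0..<t} \<inter> slot i k) else 0)" for p
  proof (cases "p = v")
    case True
    then have "{u \<in> {0..<t}. parallel_execution M p u = Some (i, k, v)} = {0..<t} \<inter> slot i k"
      using assms by (auto simp: parallel_execution_eq_Some_iff)
    then show ?thesis using True by simp
  qed (simp add: parallel_execution_eq_Some_iff)
  then show ?thesis using assms by (simp add: received_work_def)
qed

end

section \<open>The processor demand of a federated schedule\<close>

text \<open>The first job, released at \<open>0\<close>, must receive all its work by its deadline.
  In this window each processor of \<open>P\<close> supplies at most speed times deadline, and the
  others supply nothing.\<close>

lemma federated_demand:
  assumes valid: "valid_execution M s ts r e" and meets: "meets_deadlines M s ts r e"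
    and i: "i < length ts" and fin: "finite (subtasks (ts ! i))"
    and r0: "r i 0 = 0" and d: "0 \<le> deadline (ts ! i)" and s: "0 \<le> s"
    and P: "P \<subseteq> {..<M}" and only: "\<And>p t k v. e p t = Some (i, k, v) \<Longrightarrow> p \<in> P"
  shows "(\<Sum>v\<in>subtasks (ts ! i). work (ts ! i) v) \<le> s * real (card P) * deadline (ts ! i)"
proof -
  let ?V = "subtasks (ts ! i)" and ?d = "deadline (ts ! i)"
  define E where "E p v = {u \<in> {0..<?d}. e p u = Some (i, 0, v)}" for p v
  have E: "E p v \<in> sets borel" for p v
  proof -
    have "E p v = {0..<?d} \<inter> {u. e p u = Some (i, 0, v)}" unfolding E_def by auto
    then show ?thesis using valid unfolding valid_execution_def by auto
  qed
  have f: "E p v \<in> fmeasurable lborel" for p v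
    by (rule fmeasurableI2[of "{0..<?d}"]) (use E in \<open>auto simp: E_def\<close>)
  have "(\<Sum>v\<in>?V. work (ts ! i) v) \<le> (\<Sum>v\<in>?V. received_work M s e (i, 0, v) ?d)"
  proof (rule sum_mono)
    fix v assume "v \<in> ?V"
    then have "work (ts ! i) v \<le> received_work M s e (i, 0, v) (r i 0 + ?d)"
      using meets i unfolding meets_deadlines_def by blast
    then show "work (ts ! i) v \<le> received_work M s e (i, 0, v) ?d" using r0 by simp
  qed
  also have "\<dots> = s * (\<Sum>p<M. \<Sum>v\<in>?V. measure lborel (E p v))"
    unfolding received_work_def E_def[symmetric] sum_distrib_left by (rule sum.swap)
  also have "(\<Sum>p<M. \<Sum>v\<in>?V. measure lborel (E p v)) = (\<Sum>p\<in>P. \<Sum>v\<in>?V. measure lborel (E p v))"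
  proof (rule sum.mono_neutral_right)
    show "\<forall>p\<in>{..<M} - P. (\<Sum>v\<in>?V. measure lborel (E p v)) = 0"
    proof
      fix p assume "p \<in> {..<M} - P"
      then have "E p v = {}" for v using only unfolding E_def by blast
      then show "(\<Sum>v\<in>?V. measure lborel (E p v)) = 0" by simp
    qed
  qed (use P in auto)
  also have "s * \<dots> \<le> s * (\<Sum>p\<in>P. ?d)"
  proof (intro mult_left_mono sum_mono s)
    fix p
    \<comment> \<open>A processor executes one subtask at a time, so on a fixed \<open>p\<close> the
      subtasks share the window without overlap.\<close>
    have "disjoint_family_on (E p) ?V"
      unfolding disjoint_family_on_def E_def by auto
    then have "(\<Sum>v\<in>?V. measure lborel (E p v)) = measure lborel (\<Union>v\<in>?V. E p v)"
      using f fin by (intro measure_UNION'[symmetric]) (auto simp: disjoint_family_on_def pairwise_def disjnt_def)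
    also have "\<dots> \<le> measure lborel {0..<?d}"
      using E fin by (intro measure_mono_fmeasurable) (auto simp: E_def)
    finally show "(\<Sum>v\<in>?V. measure lborel (E p v)) \<le> ?d" using d by simp
  qed
  finally show ?thesis by (simp add: mult.assoc)
qed

section \<open>The hard task system\<close>

text \<open>The increments of the sequence \<open>K ^ i\<close>, starting with \<open>1\<close>, so
  that partial sums telescope.\<close>

definition layer_work :: "real \<Rightarrow> nat \<Rightarrow> real" where
  "layer_work K i = (case i of 0 \<Rightarrow> 1 | Suc j \<Rightarrow> K ^ Suc j - K ^ j)"

text \<open>For \<open>1 < K\<close> the period is at least the sum of any two deadlines with index
  below \<open>N\<close>, as \<open>long_period\<close> requires.\<close>

definition layer_task :: "nat \<Rightarrow> nat \<Rightarrow> real \<Rightarrow> nat \<Rightarrow> dag_task" where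
  "layer_task M N K i = \<lparr>subtasks = {..<M}, precedence = {}, work = (\<lambda>_. layer_work K i),
     deadline = K ^ i, period = 2 * K ^ N\<rparr>"

definition layered_system :: "nat \<Rightarrow> nat \<Rightarrow> real \<Rightarrow> dag_task list" where
  "layered_system M N K = map (layer_task M N K) [0..<N]"

lemma length_layered_system [simp]: "length (layered_system M N K) = N"
  by (simp add: layered_system_def)

lemma nth_layered_system [simp]: "i < N \<Longrightarrow> layered_system M N K ! i = layer_task M N K i"
  by (simp add: layered_system_def)

lemma layer_task_simps [simp]:
  "subtasks (layer_task M N K i) = {..<M}"
  "precedence (layer_task M N K i) = {}"
  "work (layer_task M N K i) = (\<lambda>_. layer_work K i)"
  "deadline (layer_task M N K i) = K ^ i"
  "period (layer_task M N K i) = 2 * K ^ N"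
  by (simp_all add: layer_task_def)

lemma layer_work_pos: "1 < K \<Longrightarrow> 0 < layer_work K i"
  by (auto simp: layer_work_def split: nat.split)

lemma sum_layer_work: "(\<Sum>j\<le>i. layer_work K j) = K ^ i"
  by (induction i) (auto simp: layer_work_def)

lemma density_layer_work:
  "0 < K \<Longrightarrow> layer_work K i / K ^ i = (if i = 0 then 1 else 1 - 1 / K)"
  by (cases i) (auto simp: layer_work_def field_simps)

text \<open>The first layer has density \<open>1\<close> and each of the others
  \<open>1 - 1 / K\<close>, and \<open>1 + (N - 1) * (1 - 1 / K)\<close> is the stated
  value.\<close>

lemma sum_density_layer_work:
  assumes "0 < K" "1 \<le> N"
  shows "(\<Sum>i<N. layer_work K i / K ^ i) = real N - (real N - 1) / K"
  using assms(2)
proof (induction N rule: dec_induct)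
  case base
  show ?case using density_layer_work[OF assms(1), of 0] by simp
next
  case (step n)
  then show ?case using assms(1) by (simp add: density_layer_work field_simps)
qed

section \<open>Admissibility and feasibility of the system\<close>

lemma constrained_deadline_layered_system:
  assumes "1 \<le> M" "1 < K"
  shows "constrained_deadline_system (layered_system M N K)"
proof -
  have "dag_task (layer_task M N K i)" for i
    using assms layer_work_pos[OF assms(2)]
    by (auto simp: dag_task_def acyclic_def lessThan_empty_iff)
  moreover have "K ^ i \<le> 2 * K ^ N" if "i < N" for i
  proof -
    have "K ^ i \<le> K ^ N" using that assms by (intro power_increasing) auto
    then show ?thesis using assms zero_less_power[of K N] by linarith
  qed
  ultimately show ?thesis
    unfolding constrained_deadline_system_def by (auto simp: layered_system_def)
qed

lemma feasible_layered_system: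
  assumes K: "1 < K"
  shows "\<exists>S. feasible_schedule M 1 (layered_system M N K) S"
proof -
  let ?ts = "layered_system M N K"
  have "\<exists>e. valid_execution M 1 ?ts r e \<and> meets_deadlines M 1 ?ts r e"
    if legal: "legal_releases ?ts r" for r
  proof -
    \<comment> \<open>Every processor gets one subtask of each job, so all of them face the same
      one-processor problem; \<open>demand\<close> holds with equality by telescoping.\<close>
    interpret deadline_monotonic N "layer_work K" "\<lambda>i. K ^ i" "2 * K ^ N" r
    proof
      fix i j assume "i < N" "j < N"
      then have "K ^ i \<le> K ^ N" "K ^ j \<le> K ^ N" using K by (auto intro: power_increasing)
      then show "K ^ i + K ^ j \<le> 2 * K ^ N" by simp
    qed (use legal K in \<open>auto simp: layer_work_pos sum_layer_work legal_releases_def\<close>)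
    let ?e = "parallel_execution M"
    have "valid_execution M 1 ?ts r ?e"
      unfolding valid_execution_def
    proof (intro conjI allI impI)
      fix p :: nat and x :: "nat \<times> nat \<times> nat"
      obtain i k v where x: "x = (i, k, v)" by (metis prod_cases3)
      have "{t. ?e p t = Some x} = (if p < M \<and> v = p \<and> i < N then slot i k else {})"
        by (auto simp: x parallel_execution_eq_Some_iff)
      then show "{t. ?e p t = Some x} \<in> sets borel" using slot_borel by simp
    next
      fix p q t x assume "?e p t = Some x" "?e q t = Some x"
      then show "p = q" by (cases x) (auto simp: parallel_execution_eq_Some_iff)
    next
      fix p t i k v assume "?e p t = Some (i, k, v)"
      then have a: "p < M" "v = p" "i < N" "t \<in> slot i k"
        by (auto simp: parallel_execution_eq_Some_iff)
      then show "p < M" "i < length ?ts" "v \<in> subtasks (?ts ! i)" by auto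
      show "r i k \<le> t" using slot_subset[OF a(3), of k] a(4) by auto
      show "received_work M 1 ?e (i, k, v) t < work (?ts ! i) v"
        using a measure_slot_before by (simp add: received_work_parallel_execution)
      fix u assume "(u, v) \<in> precedence (?ts ! i)"
      then show "work (?ts ! i) u \<le> received_work M 1 ?e (i, k, u) t" using a by simp
    qed
    moreover have "meets_deadlines M 1 ?ts r ?e"
      unfolding meets_deadlines_def
      by (auto simp: received_work_parallel_execution measure_slot
          Int_absorb1[OF slot_subset_before_deadline])
    ultimately show ?thesis by blast
  qed
  then show ?thesis unfolding feasible_schedule_def by metis
qed

section \<open>Lower bound on the speed of a federated schedule\<close>

lemma layered_system_speed_bound:
  assumes M: "1 \<le> M" and N: "1 \<le> N" and K: "1 < K"
    and fed: "federated_schedule M (layered_system M N K) S"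
    and feas: "feasible_schedule M s (layered_system M N K) S"
  shows "(1 - 1 / K) * real M \<le> s \<or> real N - (real N - 1) / K \<le> s"
proof (rule disjCI)
  assume slow: "\<not> real N - (real N - 1) / K \<le> s"
  let ?ts = "layered_system M N K"
  \<comment> \<open>Strictly periodic releases, all starting at time \<open>0\<close>; the bound
    counts only the first jobs.\<close>
  define r :: releases where "r i k = real k * (2 * K ^ N)" for i k
  have legal: "legal_releases ?ts r"
    using K by (auto simp: legal_releases_def r_def algebra_simps)
  have valid: "valid_execution M s ?ts r (S r)" and meets: "meets_deadlines M s ?ts r (S r)"
    using feas legal unfolding feasible_schedule_def by auto
  obtain a where alloc: "valid_allocation M N a"
    and only: "\<And>p t i k v. S r p t = Some (i, k, v) \<Longrightarrow> p \<in> processors (a i)"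
    using fed legal unfolding federated_schedule_def by (metis length_layered_system)
  \<comment> \<open>The speed is an arbitrary real here. A negative one would make all received work
    nonpositive, while the first task needs positive work.\<close>
  have s: "0 \<le> s"
  proof (rule ccontr)
    assume "\<not> 0 \<le> s"
    then have "received_work M s (S r) x t \<le> 0" for x t
      unfolding received_work_def by (intro sum_nonpos) (auto simp: mult_nonpos_nonneg)
    moreover have "layer_work K 0 \<le> received_work M s (S r) (0, 0, 0) (r 0 0 + K ^ 0)"
      using meets M N unfolding meets_deadlines_def by fastforce
    ultimately show False using layer_work_pos[OF K, of 0] by (meson not_less order_trans)
  qed
  have sub: "processors (a i) \<subseteq> {..<M}" if "i < N" for i
    using alloc that unfolding valid_allocation_def by blast
  have density: "real M * (layer_work K i / K ^ i) \<le> s * real (card (processors (a i)))"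
    if i: "i < N" for i
  proof -
    have "(\<Sum>v\<in>subtasks (?ts ! i). work (?ts ! i) v)
        \<le> s * real (card (processors (a i))) * deadline (?ts ! i)"
      using i K sub[OF i] only
      by (intro federated_demand[OF valid meets _ _ _ _ s]) (auto simp: r_def)
    then show ?thesis using i K by (simp add: field_simps)
  qed
  show "(1 - 1 / K) * real M \<le> s"
  \<comment> \<open>The single processor of a sequential task must cover a density of at least
    \<open>(1 - 1 / K) * M\<close>. Without sequential tasks all processor sets are dedicated, hence
    disjoint, and the densities add up against the capacity of all \<open>M\<close>
    processors.\<close>
  proof (cases "\<exists>i<N. \<exists>p. a i = Sequential p")
    case True
    then obtain i p where i: "i < N" and "a i = Sequential p" by blast
    then have "real M * (layer_work K i / K ^ i) \<le> s" using density[OF i] by simp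
    moreover have "1 - 1 / K \<le> layer_work K i / K ^ i" using K by (simp add: density_layer_work)
    then have "real M * (1 - 1 / K) \<le> real M * (layer_work K i / K ^ i)"
      by (intro mult_left_mono) auto
    ultimately show ?thesis by (simp add: mult.commute)
  next
    case False
    have disj: "processors (a i) \<inter> processors (a j) = {}" if ij: "i < N" "j < N" "i \<noteq> j" for i j
    proof -
      obtain P where "a j = Dedicated P" using False ij(2) by (cases "a j") auto
      moreover from this have "processors (a i) \<inter> P = {}"
        using alloc ij unfolding valid_allocation_def by blast
      ultimately show ?thesis by simp
    qed
    have "real M * (real N - (real N - 1) / K) = (\<Sum>i<N. real M * (layer_work K i / K ^ i))"
      unfolding sum_distrib_left[symmetric, of "real M"] using K N
      by (subst sum_density_layer_work) auto
    also have "\<dots> \<le> (\<Sum>i<N. s * real (card (processors (a i))))"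
      using density by (intro sum_mono) auto
    also have "\<dots> = s * real (card (\<Union>i<N. processors (a i)))"
    proof -
      have "finite (processors (a i))" if "i < N" for i
        using sub[OF that] finite_subset by blast
      then have "card (\<Union>i<N. processors (a i)) = (\<Sum>i<N. card (processors (a i)))"
        using disj by (intro card_UN_disjoint) auto
      then show ?thesis by (simp add: sum_distrib_left)
    qed
    also have "\<dots> \<le> s * real (card {..<M})"
    proof -
      have "card (\<Union>i<N. processors (a i)) \<le> card {..<M}"
        using sub by (intro card_mono) auto
      then show ?thesis using s by (intro mult_left_mono) auto
    qed
    \<comment> \<open>Cancelling \<open>M\<close> contradicts \<open>slow\<close>.\<close>
    finally have "real M * (real N - (real N - 1) / K) \<le> real M * s" by (simp add: mult.commute)
    then show ?thesis using slow M by simp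
  qed
qed

theorem theorem1:
  fixes M N :: nat and K :: real
  assumes "M \<ge> 2" and "N \<ge> 1" and "K \<ge> 2"
  shows "(\<forall>A B s. federated_algorithm M A \<longrightarrow> optimal_algorithm M B \<longrightarrow>
            has_speedup_factor M N A B s \<longrightarrow>
            min ((1 - 1 / K) * real M) (real N - (real N - 1) / K) \<le> s) \<and>
         (\<exists>ts. constrained_deadline_system ts \<and> length ts = N \<and>
            (\<exists>S. feasible_schedule M 1 ts S) \<and>
            (\<forall>s. s < (1 - 1 / K) * real M \<longrightarrow> s < real N - (real N - 1) / K \<longrightarrow>
               \<not> (\<exists>S. federated_schedule M ts S \<and> feasible_schedule M s ts S)))"
proof -
  let ?ts = "layered_system M N K"
  have K: "1 < K" and M: "1 \<le> M" using assms by auto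
  have ts: "constrained_deadline_system ?ts" by (rule constrained_deadline_layered_system[OF M K])
  have feas: "\<exists>S. feasible_schedule M 1 ?ts S" by (rule feasible_layered_system[OF K])
  note bound = layered_system_speed_bound[OF M assms(2) K]
  have "min ((1 - 1 / K) * real M) (real N - (real N - 1) / K) \<le> s"
    if A: "federated_algorithm M A" and B: "optimal_algorithm M B"
      and AB: "has_speedup_factor M N A B s" for A B s
  proof -
    have "feasible_schedule M 1 ?ts (B ?ts 1)"
      using B ts feas unfolding optimal_algorithm_def by simp
    then have "feasible_schedule M s ?ts (A ?ts s)"
      using AB ts unfolding has_speedup_factor_def by simp
    \<comment> \<open>The positivity of \<open>s\<close> that \<open>federated_algorithm\<close>
      asks for is part of \<open>has_speedup_factor\<close>.\<close>
    moreover have "federated_schedule M ?ts (A ?ts s)"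
      using A AB ts unfolding federated_algorithm_def has_speedup_factor_def by simp
    ultimately show ?thesis using bound by (auto simp: min_le_iff_disj)
  qed
  moreover have "\<not> (\<exists>S. federated_schedule M ?ts S \<and> feasible_schedule M s ?ts S)"
    if "s < (1 - 1 / K) * real M" "s < real N - (real N - 1) / K" for s
    using bound[of _ s] that by force
  ultimately show ?thesis using ts feas length_layered_system by blast
qed

end
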